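(* Let $a$ and $k$ be positive integers with $k>\lambda(a)+1$. The smallest multiple $n$ of $a$ with $\lambda(n)=k$ is $a\,g(k-\lambda(a))$. If $a$ is odd, then the only multiple $n$ of $a$ with $\lambda(n)=\lambda(a)+1$ is $4a$. If $a$ is even, then the only multiple $n$ of $a$ with $\lambda(n)=\lambda(a)+1$ is $2a$.
   Context: Let $\overline{\psi}$ be the multiplicative arithmetic function with $\overline{\psi}(p^{\alpha})=p^{\alpha-1}(p+1)$ for odd primes $p$ and $\overline{\psi}(2^{\alpha})=2^{\alpha-1}$, for all positive integers $\alpha$ (so $\overline{\psi}(1)=1$). For $n>1$, $\lambda(n)$ is the unique nonnegative integer with $\overline{\psi}^{\lambda(n)}(n)=2$ (where $\overline{\psi}^k$ is the $k$-th iterate, $\overline{\psi}^0(n)=n$), and $\lambda(1)=0$. Define $g(k)$ for integers $k\geq 2$ by $g(k)=5^{k/3}$ if $k\equiv 0\pmod 3$, $g(k)=9\cdot 5^{(k-4)/3}$ if $k\equiv 1\pmod 3$, and $g(k)=3\cdot 5^{(k-2)/3}$ if $k\equiv 2\pmod 3$. *)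

theory Defs
  imports "HOL-Number_Theory.Number_Theory"
begin

text \<open>The values at prime powers are extended multiplicatively to all positive integers;
  the value at \<open>0\<close> is irrelevant.\<close>

definition psibar :: "nat \<Rightarrow> nat" where
  "psibar n = (\<Prod>p\<in>prime_factors n.
     if p = 2 then 2 ^ (multiplicity p n - 1) else p ^ (multiplicity p n - 1) * (p + 1))"

lemma psibar_1 [simp]: "psibar 1 = 1"
  by (simp add: psibar_def)

lemma psibar_prime_power:
  assumes "prime p" "odd p" "\<alpha> > 0"
  shows "psibar (p ^ \<alpha>) = p ^ (\<alpha> - 1) * (p + 1)"
proof -
  have "prime_factors (p ^ \<alpha>) = {p}"
    using assms by (simp add: prime_factors_power prime_prime_factors)
  moreover have "p \<noteq> 2"
    using assms(2) by auto
  moreover have "multiplicity p (p ^ \<alpha>) = \<alpha>"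
    using assms(1) by (simp add: multiplicity_prime_power)
  ultimately show ?thesis by (simp add: psibar_def)
qed

lemma psibar_2_power:
  assumes "\<alpha> > 0"
  shows "psibar (2 ^ \<alpha>) = 2 ^ (\<alpha> - 1)"
  using assms by (simp add: psibar_def prime_factors_power prime_prime_factors)

lemma psibar_mult_coprime:
  assumes "coprime m n" "m > 0" "n > 0"
  shows "psibar (m * n) = psibar m * psibar n"
proof -
  let ?f = "\<lambda>n p. if p = 2 then 2 ^ (multiplicity p n - 1)
              else p ^ (multiplicity p n - 1) * (p + 1 :: nat)"
  have disj: "prime_factors m \<inter> prime_factors n = {}"
    using assms(1) by (auto simp: in_prime_factors_iff dest: coprime_common_divisor_nat)
  have mult: "multiplicity p (m * n) = multiplicity p m + multiplicity p n" if "prime p" for p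
    using assms that by (intro prime_elem_multiplicity_mult_distrib) auto
  have m: "?f (m * n) p = ?f m p" if "p \<in> prime_factors m" for p
  proof -
    have "multiplicity p n = 0"
      using that disj assms(3) by (intro not_dvd_imp_multiplicity_0) (auto simp: in_prime_factors_iff)
    thus ?thesis using mult[of p] that by (auto simp: in_prime_factors_iff)
  qed
  have n: "?f (m * n) p = ?f n p" if "p \<in> prime_factors n" for p
  proof -
    have "multiplicity p m = 0"
      using that disj assms(2) by (intro not_dvd_imp_multiplicity_0) (auto simp: in_prime_factors_iff)
    thus ?thesis using mult[of p] that by (auto simp: in_prime_factors_iff)
  qed
  have "psibar (m * n) = (\<Prod>p\<in>prime_factors m \<union> prime_factors n. ?f (m * n) p)"
    using assms by (simp add: psibar_def prime_factors_product)
  also have "\<dots> = (\<Prod>p\<in>prime_factors m. ?f (m * n) p) * (\<Prod>p\<in>prime_factors n. ?f (m * n) p)"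
    using disj by (intro prod.union_disjoint) auto
  also have "\<dots> = (\<Prod>p\<in>prime_factors m. ?f m p) * (\<Prod>p\<in>prime_factors n. ?f n p)"
    by (intro arg_cong2[where f = "(*)"] prod.cong refl m n)
  finally show ?thesis by (simp add: psibar_def)
qed

text \<open>For \<open>n > 1\<close> the index is unique: the iterates eventually reach \<open>2\<close>, and from there on
  they are constantly \<open>1\<close>. The value at \<open>0\<close> is irrelevant.\<close>

definition lam :: "nat \<Rightarrow> nat" where
  "lam n = (if n = 1 then 0 else (THE k. (psibar ^^ k) n = 2))"

text \<open>Meaningful for \<open>k \<ge> 2\<close> only, where every division below is exact and no subtraction
  truncates.\<close>

definition gfun :: "nat \<Rightarrow> nat" where
  "gfun k = (if k mod 3 = 0 then 5 ^ (k div 3)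
             else if k mod 3 = 1 then 9 * 5 ^ ((k - 4) div 3)
             else 3 * 5 ^ ((k - 2) div 3))"

end

theory Submission
  imports Defs
begin

text \<open>Let \<open>wt\<close> be the completely additive function with \<open>wt 2 = 1\<close> and \<open>wt p = wt (p + 1)\<close> for odd
  primes \<open>p\<close>. One application of \<^const>\<open>psibar\<close> lowers \<open>wt\<close> by one on even numbers and preserves it
  on odd ones, and all numbers in an orbit above \<open>2\<close> are even after the first step; hence
  \<open>lam n\<close> is \<open>wt n\<close> for odd \<open>n\<close> and \<open>wt n - 1\<close> for even \<open>n\<close>. By additivity, everything reduces to
  finding the smallest \<open>m\<close> of given weight. This is a submultiplicative function of the weight,
  which takes care of composite numbers, while a prime \<open>p\<close> of weight \<open>k + 1\<close> is at least
  \<open>2 * m - 1\<close> with \<open>m\<close> of weight \<open>k\<close>.\<close>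

function wt :: "nat \<Rightarrow> nat" where
  "wt n = (\<Sum>p\<in>#prime_factorization n. if p = 2 then 1 else Suc (wt (Suc p div 2)))"
  by auto
termination
proof (relation "measure id", goal_cases)
  case (2 n p)
  hence "prime p" "p dvd n" "n > 0" by (auto simp: in_prime_factors_iff)
  moreover from this have "p \<ge> 2" "p \<le> n" by (auto simp: prime_ge_2_nat dvd_imp_le)
  ultimately show ?case using 2 by auto
qed auto

declare wt.simps [simp del]

lemma wt_1 [simp]: "wt (Suc 0) = 0"
  by (simp add: wt.simps)

lemma wt_mult: "a > 0 \<Longrightarrow> b > 0 \<Longrightarrow> wt (a * b) = wt a + wt b"
  by (simp add: wt.simps[of "a * b"] wt.simps[of a] wt.simps[of b] prime_factorization_mult)

lemma wt_2 [simp]: "wt 2 = 1"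
  by (simp add: wt.simps prime_factorization_prime)

text \<open>The definition recurses through \<open>Suc p div 2\<close> because \<open>Suc p\<close>
  itself may exceed the argument. The extra \<open>Suc\<close> there stands for the factor 2 split
  off, so the intended rule is recovered here.\<close>

lemma wt_odd_prime:
  assumes "prime p" "odd p"
  shows "wt p = wt (Suc p)"
proof -
  have "wt p = Suc (wt (Suc p div 2))"
    using assms by (subst wt.simps) (auto simp: prime_factorization_prime)
  also have "\<dots> = wt (2 * (Suc p div 2))"
    by (subst wt_mult) (use prime_gt_0_nat[OF assms(1)] in auto)
  also have "2 * (Suc p div 2) = Suc p"
    using assms by simp
  finally show ?thesis .
qed

lemma wt_power: "a > 0 \<Longrightarrow> wt (a ^ k) = k * wt a"
  by (induction k) (auto simp: wt_mult)

lemma wt_prod: "(\<And>x. x \<in> A \<Longrightarrow> f x > 0) \<Longrightarrow> wt (\<Prod>x\<in>A. f x) = (\<Sum>x\<in>A. wt (f x))"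
proof (induction A rule: infinite_finite_induct)
  case (insert x A)
  have "(\<Prod>x\<in>A. f x) > 0" using insert by (auto intro: prod_pos)
  thus ?case using insert by (simp add: wt_mult)
qed auto

lemma wt_pos: "n > 1 \<Longrightarrow> wt n > 0"
proof -
  assume "n > 1"
  then obtain p where p: "prime p" "p dvd n" using prime_factor_nat[of n] by auto
  then obtain m where m: "n = p * m" by (elim dvdE)
  have "wt p > 0"
    using p by (subst wt.simps) (auto simp: prime_factorization_prime)
  thus ?thesis using m \<open>n > 1\<close> by (cases "p = 0"; cases "m = 0") (auto simp: wt_mult)
qed

lemma wt_eq_0_iff: "n > 0 \<Longrightarrow> wt n = 0 \<longleftrightarrow> n = 1"
  using wt_pos[of n] by (cases "n = 1") auto

section \<open>The weight along orbits of \<open>psibar\<close>\<close>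

lemma psibar_pos: "psibar n > 0"
  unfolding psibar_def by (intro prod_pos) (auto simp: in_prime_factors_iff prime_gt_0_nat)

text \<open>Compare prime by prime: trading one factor \<open>p\<close> for \<open>p + 1\<close>
  keeps the weight when \<open>p\<close> is odd, while dropping one factor 2 costs exactly
  one.\<close>

lemma wt_psibar:
  assumes "n > 0"
  shows "wt n = wt (psibar n) + of_bool (even n)"
proof -
  let ?m = "\<lambda>p. multiplicity p n"
  have mpos: "?m p > 0" if "p \<in> prime_factors n" for p
    using that by (simp add: prime_factors_multiplicity)
  have pr: "prime p" "p > 0" if "p \<in> prime_factors n" for p
    using that by (auto simp: in_prime_factors_iff prime_gt_0_nat)
  have "wt n = wt (\<Prod>p\<in>prime_factors n. p ^ ?m p)"
    using assms by (simp add: prime_factorization_nat[symmetric])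
  also have "\<dots> = (\<Sum>p\<in>prime_factors n. ?m p * wt p)"
    by (subst wt_prod) (auto simp: pr wt_power)
  also have "\<dots> = (\<Sum>p\<in>prime_factors n. wt (if p = 2 then 2 ^ (?m p - 1) else p ^ (?m p - 1) * (p + 1))
                        + (if p = 2 then 1 else 0))"
  proof (intro sum.cong refl, goal_cases)
    case (1 p)
    show ?case
    proof (cases "p = 2")
      case True
      with mpos[OF 1] show ?thesis by (simp add: wt_power)
    next
      case False
      hence "odd p" using pr[OF 1] primes_dvd_imp_eq two_is_prime_nat by blast
      moreover obtain j where "?m p = Suc j" using mpos[OF 1] gr0_conv_Suc by blast
      ultimately show ?thesis
        using False pr[OF 1] wt_odd_prime[of p] by (simp add: wt_mult wt_power del: mult_Suc_right)
    qed
  qed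
  also have "\<dots> = wt (psibar n) + (\<Sum>p\<in>prime_factors n. if p = 2 then 1 else 0)"
    unfolding psibar_def sum.distrib
    by (subst wt_prod) (auto simp: pr)
  also have "(\<Sum>p\<in>prime_factors n. if p = 2 then 1 else 0 :: nat) = of_bool (even n)"
    using assms by (auto simp: in_prime_factors_iff)
  finally show ?thesis .
qed

text \<open>Either 4 divides \<open>n\<close> and a factor 2 survives, or an odd prime
  \<open>p\<close> divides \<open>n\<close> and contributes the even factor
  \<open>p + 1\<close>.\<close>

lemma even_psibar:
  assumes "n > 2"
  shows "even (psibar n)"
proof (cases "4 dvd n")
  case True
  hence "2 ^ 2 dvd n" by simp
  hence "multiplicity 2 n \<ge> 2" using assms by (intro multiplicity_geI) auto
  moreover have "2 \<in> prime_factors n"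
    using True assms by (auto simp: in_prime_factors_iff intro: dvd_trans[of 2 4 n])
  ultimately show ?thesis
    unfolding psibar_def by (subst even_prod_iff) (auto intro!: bexI[of _ 2])
next
  case False
  obtain m where m: "m dvd n" "odd m" "m \<noteq> 1"
  proof (cases "even n")
    case True
    then obtain m where "n = 2 * m" by (elim dvdE)
    with False assms that[of m] show ?thesis by fastforce
  next
    case odd: False
    from that[of n] odd assms show ?thesis by auto
  qed
  then obtain p where "prime p" "p dvd m" using prime_factor_nat by blast
  hence "p \<in> prime_factors n" "odd p"
    using m assms by (auto simp: in_prime_factors_iff intro: dvd_trans)
  thus ?thesis
    unfolding psibar_def by (subst even_prod_iff) (auto intro!: bexI[of _ p])
qed

text \<open>The right-hand side determines \<open>k\<close>, so the equivalence yields uniqueness of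
  the index as well as existence.\<close>

lemma funpow_psibar_eq_2_iff:
  "n > 1 \<Longrightarrow> (psibar ^^ k) n = 2 \<longleftrightarrow> wt n = k + of_bool (even n)"
proof (induction k arbitrary: n)
  case 0
  show ?case
  proof (cases "n = 2")
    case False
    with 0 have "psibar n > 1" using even_psibar[of n] psibar_pos[of n] by (cases "psibar n = 1") auto
    with wt_pos[of "psibar n"] wt_psibar[of n] 0 False show ?thesis by auto
  qed auto
next
  case (Suc k)
  show ?case
  proof (cases "n = 2")
    case True
    have "psibar 2 = 1" using psibar_2_power[of 1] by simp
    \<comment> \<open>Beyond 2 the orbit stays at 1 and never returns to 2.\<close>
    moreover have "(psibar ^^ k) 1 = 1" by (induction k) (auto simp del: One_nat_def)
    ultimately show ?thesis using True by (simp add: funpow_swap1 del: One_nat_def)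
  next
    case False
    hence ev: "even (psibar n)" using even_psibar[of n] Suc.prems by auto
    hence "psibar n > 1" using psibar_pos[of n] by (cases "psibar n = 1") auto
    from Suc.IH[OF this] ev wt_psibar[of n] Suc.prems show ?thesis
      by (auto simp: funpow_swap1)
  qed
qed

lemma wt_eq_lam:
  assumes "n > 0"
  shows "wt n = lam n + of_bool (even n)"
proof (cases "n = 1")
  case False
  with assms have "n > 1" by simp
  \<comment> \<open>This keeps the natural subtraction below from truncating.\<close>
  have "wt n \<ge> of_bool (even n)" using wt_pos[OF \<open>n > 1\<close>] by auto
  hence "(THE k. (psibar ^^ k) n = 2) = wt n - of_bool (even n)"
    by (intro the_equality) (auto simp: funpow_psibar_eq_2_iff[OF \<open>n > 1\<close>])
  thus ?thesis using False \<open>wt n \<ge> _\<close> by (simp add: lam_def)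
qed (auto simp: lam_def)

text \<open>The smallest number of weight \<open>k\<close>. It agrees with \<^const>\<open>gfun\<close> except at \<open>k = 1\<close>.\<close>

fun min_wt :: "nat \<Rightarrow> nat" where
  "min_wt 0 = 1"
| "min_wt (Suc 0) = 2"
| "min_wt (Suc (Suc 0)) = 3"
| "min_wt (Suc (Suc (Suc 0))) = 5"
| "min_wt (Suc (Suc (Suc (Suc 0)))) = 9"
| "min_wt (Suc (Suc (Suc (Suc (Suc n))))) = 5 * min_wt (Suc (Suc n))"

section \<open>Lower bound for numbers of given weight\<close>

text \<open>Serves the prime case of \<open>min_wt_le\<close>, where \<open>n = 2 * m - 1\<close>.
  It fails at \<open>k = 0\<close>, since 2 + 1 > 2.\<close>

lemma min_wt_Suc: "k > 0 \<Longrightarrow> min_wt (Suc k) + 1 \<le> 2 * min_wt k"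
  by (induction k rule: min_wt.induct) auto

lemma min_wt_less_Suc: "min_wt k < min_wt (Suc k)"
  by (induction k rule: min_wt.induct) auto

text \<open>The multipliers are \<open>min_wt i\<close> for \<open>i\<close> from 1 to 4: these are
  the base cases of submultiplicativity.\<close>

lemma min_wt_small_add:
  "min_wt (Suc j) \<le> 2 * min_wt j"
  "min_wt (Suc (Suc j)) \<le> 3 * min_wt j"
  "min_wt (Suc (Suc (Suc j))) \<le> 5 * min_wt j"
  "min_wt (Suc (Suc (Suc (Suc j)))) \<le> 9 * min_wt j"
  by (induction j rule: min_wt.induct) auto

lemma min_wt_add: "min_wt (i + j) \<le> min_wt i * min_wt j"
proof (induction i rule: min_wt.induct)
  case (6 n)
  thus ?case using min_wt_small_add(3)[of "Suc (Suc (n + j))"] by simp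
qed (use min_wt_small_add[of j] in auto)

lemma min_wt_le: "n > 0 \<Longrightarrow> min_wt (wt n) \<le> n"
proof (induction n rule: less_induct)
  case (less n)
  consider "n = 1" | "n = 2" | "prime n" "n > 2" | "n > 1" "\<not> prime n"
    using less.prems prime_ge_2_nat[of n] by linarith
  thus ?case
  proof cases
    case 3
    define m where "m = Suc n div 2"
    have "odd n" using 3 prime_odd_nat by blast
    hence m: "Suc n = 2 * m" "m > 1" "m < n" using 3 unfolding m_def by auto
    have "wt n = Suc (wt m)"
      using wt_odd_prime[OF 3(1) \<open>odd n\<close>] m by (simp add: wt_mult)
    moreover have "min_wt (wt m) \<le> m" using less.IH[of m] m by simp
    \<comment> \<open>Here \<open>m > 1\<close> makes \<open>wt m\<close> positive, as
      \<open>min_wt_Suc\<close> requires.\<close>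
    ultimately show ?thesis using min_wt_Suc[OF wt_pos[OF m(2)]] m by simp
  next
    case 4
    then obtain p where p: "prime p" "p dvd n" using prime_factor_nat[of n] by auto
    then obtain m where n: "n = p * m" by (elim dvdE)
    have pos: "p > 1" "m > 0" using p n less.prems by (auto intro: prime_gt_1_nat simp del: One_nat_def)
    have "m \<noteq> 1" using n p 4 by auto
    hence "p < n" "m < n" using n pos by auto
    hence "min_wt (wt p) * min_wt (wt m) \<le> p * m"
      using less.IH pos by (intro mult_le_mono) auto
    moreover have "min_wt (wt n) \<le> min_wt (wt p) * min_wt (wt m)"
      using pos by (simp add: n wt_mult min_wt_add)
    ultimately show ?thesis using n by linarith
  qed auto
qed

text \<open>The bound on \<open>k\<close> excludes 1, where \<open>k - 4\<close> truncates and
  \<open>gfun 1 = gfun 4 = 9\<close>.\<close>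

lemma gfun_add_3: "k \<ge> 2 \<Longrightarrow> gfun (k + 3) = 5 * gfun k"
proof -
  assume "k \<ge> 2"
  consider q where "k = 3 * q" | q where "k = 3 * q + 4" | q where "k = 3 * q + 2"
  proof -
    have "k = 3 * (k div 3) + k mod 3" by simp
    moreover have "k mod 3 < 3" by simp
    ultimately consider "k = 3 * (k div 3)" | "k = 3 * (k div 3 - 1) + 4" | "k = 3 * (k div 3) + 2"
      using \<open>k \<ge> 2\<close> by linarith
    thus ?thesis using that by metis
  qed
  thus ?thesis
  proof cases
    case (1 q)
    hence "k mod 3 = 0" "(k + 3) mod 3 = 0" "k div 3 = q" "(k + 3) div 3 = Suc q" by presburger+
    thus ?thesis by (simp add: gfun_def)
  next
    case (2 q)
    hence "k mod 3 = 1" "(k + 3) mod 3 = 1" "(k - 4) div 3 = q" "(k + 3 - 4) div 3 = Suc q"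
      by presburger+
    thus ?thesis by (simp add: gfun_def)
  next
    case (3 q)
    hence "k mod 3 = 2" "(k + 3) mod 3 = 2" "(k - 2) div 3 = q" "(k + 3 - 2) div 3 = Suc q"
      by presburger+
    thus ?thesis by (simp add: gfun_def)
  qed
qed

lemma gfun_eq_min_wt: "k \<ge> 2 \<Longrightarrow> gfun k = min_wt k"
proof (induction k rule: min_wt.induct)
  case (6 n)
  thus ?case using gfun_add_3[of "Suc (Suc n)"] by (simp add: eval_nat_numeral)
qed (auto simp: gfun_def)

lemma wt_3: "wt 3 = 2"
  using wt_odd_prime[of 3] wt_mult[of 2 2] by simp

lemma wt_5: "wt 5 = 3"
  using wt_odd_prime[of 5] wt_mult[of 2 3] by (simp add: wt_3)

lemma min_wt_pos: "min_wt k > 0"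
  by (induction k rule: min_wt.induct) auto

text \<open>Shows that the bound in \<open>min_wt_le\<close> is attained.\<close>

lemma wt_min_wt: "wt (min_wt k) = k"
proof (induction k rule: min_wt.induct)
  case 5
  show ?case using wt_mult[of 3 3] by (simp add: wt_3)
next
  case (6 n)
  thus ?case by (simp add: wt_mult wt_5 min_wt_pos)
qed (use wt_2 wt_3 wt_5 in \<open>auto simp: eval_nat_numeral\<close>)

text \<open>An odd multiplier preserves parity, so \<open>lam\<close> then grows by exactly its
  weight.\<close>

lemma odd_min_wt: "k \<ge> 2 \<Longrightarrow> odd (min_wt k)"
  by (induction k rule: min_wt.induct) auto

text \<open>Weight 1 leaves room for a single prime factor, and an odd prime has weight at least 2
  because \<open>p + 1 = 2 * q\<close> with \<open>q > 1\<close>.\<close>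

lemma wt_eq_1_iff:
  assumes "n > 0"
  shows "wt n = 1 \<longleftrightarrow> n = 2"
proof
  assume n: "wt n = 1"
  then obtain p where p: "prime p" "p dvd n" using prime_factor_nat[of n] by fastforce
  then obtain m where m: "n = p * m" by (elim dvdE)
  have pos: "p > 1" "m > 0" using p m assms by (auto intro: prime_gt_1_nat simp del: One_nat_def)
  hence "wt p + wt m = 1" using n m by (simp add: wt_mult)
  with wt_pos[OF pos(1)] have wt: "wt p = 1" "wt m = 0" by auto
  have "p = 2"
  proof (rule ccontr)
    assume "p \<noteq> 2"
    hence "odd p" using p(1) primes_dvd_imp_eq two_is_prime_nat by blast
    define q where "q = Suc p div 2"
    have q: "Suc p = 2 * q" "q > 1" using \<open>odd p\<close> pos unfolding q_def by (auto elim!: oddE)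
    hence "wt p = Suc (wt q)"
      using wt_odd_prime[OF p(1) \<open>odd p\<close>] by (simp add: wt_mult)
    with wt_pos[OF q(2)] wt show False by simp
  qed
  with wt m pos show "n = 2" by (simp add: wt_eq_0_iff)
qed simp

section \<open>Multiples of \<open>a\<close>\<close>

text \<open>The correction term records the one case where the parity changes: an even multiple of
  an odd \<open>a\<close>.\<close>

lemma lam_mult_wt:
  assumes "a > 0" "m > 0"
  shows "lam (a * m) + of_bool (odd a \<and> even m) = lam a + wt m"
proof -
  have "lam (a * m) + of_bool (even (a * m)) = lam a + of_bool (even a) + wt m"
    using assms wt_eq_lam[of "a * m"] wt_eq_lam[of a] by (simp add: wt_mult)
  thus ?thesis by (cases "even a"; cases "even m") auto
qed

text \<open>For even \<open>a\<close> the multiplier must have weight 1. For odd \<open>a\<close> an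
  odd multiplier would need weight 1, which only 2 has, so the multiplier is even of weight 2, hence
  4.\<close>

lemma lam_mult_eq_Suc_iff:
  assumes "a > 0" "m > 0"
  shows "lam (a * m) = lam a + 1 \<longleftrightarrow> m = (if even a then 2 else 4)"
proof (cases "even a")
  case True
  with lam_mult_wt[OF assms] wt_eq_1_iff[OF assms(2)] show ?thesis by auto
next
  case odd: False
  show ?thesis
  proof (cases "even m")
    case True
    then obtain m' where m': "m = 2 * m'" by (elim dvdE)
    with assms have "wt m = Suc (wt m')" by (simp add: wt_mult)
    with lam_mult_wt[OF assms] wt_eq_1_iff[of m'] odd assms m' show ?thesis by auto
  next
    case False
    with lam_mult_wt[OF assms] wt_eq_1_iff[OF assms(2)] odd show ?thesis by auto
  qed
qed

theorem theorem2p2: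
  fixes a k :: nat
  assumes "a > 0" and "k > 0" and "k > lam a + 1"
  shows "(a dvd a * gfun (k - lam a) \<and> lam (a * gfun (k - lam a)) = k \<and>
          (\<forall>n>0. a dvd n \<and> lam n = k \<longrightarrow> a * gfun (k - lam a) \<le> n)) \<and>
         (odd a \<longrightarrow> {n. n > 0 \<and> a dvd n \<and> lam n = lam a + 1} = {4 * a}) \<and>
         (even a \<longrightarrow> {n. n > 0 \<and> a dvd n \<and> lam n = lam a + 1} = {2 * a})"
proof -
  define j where "j = k - lam a"
  have j: "j \<ge> 2" "k = lam a + j" using assms by (auto simp: j_def)
  have g: "gfun (k - lam a) = min_wt j" using gfun_eq_min_wt[OF j(1)] by (simp add: j_def)
  have "lam (a * min_wt j) = k"
    using lam_mult_wt[of a "min_wt j"] odd_min_wt[OF j(1)] assms(1) j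
    by (simp add: wt_min_wt min_wt_pos)
  moreover have "a * min_wt j \<le> n" if n: "n > 0" "a dvd n" "lam n = k" for n
  proof -
    obtain m where m: "n = a * m" using n by (elim dvdE)
    with n have "m > 0" by auto
    \<comment> \<open>The weight of \<open>m\<close> is \<open>j\<close>, or \<open>j + 1\<close> if
      the parity correction applies; \<open>min_wt\<close> increases, so both suffice.\<close>
    have "min_wt j \<le> min_wt (wt m)"
      using lam_mult_wt[OF assms(1) \<open>m > 0\<close>] n m j min_wt_less_Suc[of j]
      by (cases "odd a \<and> even m") auto
    also have "\<dots> \<le> m" using min_wt_le[OF \<open>m > 0\<close>] .
    finally show ?thesis using m by simp
  qed
  moreover have "{n. n > 0 \<and> a dvd n \<and> lam n = lam a + 1} = {(if even a then 2 else 4) * a}"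
    (is "?A = _")
  proof (intro equalityI subsetI)
    fix n assume n: "n \<in> ?A"
    then obtain m where m: "n = a * m" by auto
    with n lam_mult_eq_Suc_iff[OF assms(1), of m] show "n \<in> {(if even a then 2 else 4) * a}"
      by (auto split: if_splits)
  next
    fix n assume "n \<in> {(if even a then 2 else 4) * a}"
    hence "n = a * (if even a then 2 else 4)" by simp
    with lam_mult_eq_Suc_iff[OF assms(1), of "if even a then 2 else 4"] assms(1) show "n \<in> ?A"
      by (auto split: if_splits)
  qed
  ultimately show ?thesis using g by simp
qed

end
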